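(* For $\omega>0$ let $f_\omega(t)=\sin\omega t$ and $g_\omega(t)=\cos\omega t$. The functions $f_\omega$, $g_\omega$ ($\omega>0$) form an orthogonal system in $\mathcal{C}_2^{H}$, and their norms are $$\|f_\omega\|=\|g_\omega\|=\frac{e^{\omega^2/2}}{\sqrt[4]{2\pi}}.$$ That is: each $f_\omega$ and each $g_\omega$ belongs to $\mathcal{C}^{H}$; for any two distinct functions $f,g$ from the family $\{f_\omega,g_\omega:\omega>0\}$ the limit defining $\langle f,g\rangle^{H}$ exists and equals $0$ for every $t\in\mathbb{R}$; and for every $\omega>0$, $\langle f_\omega,f_\omega\rangle^{H}=\langle g_\omega,g_\omega\rangle^{H}=e^{\omega^2}/\sqrt{2\pi}$ (for every $t\in\mathbb{R}$).
   Context: Let $H_n$ be the (physicists') Hermite polynomials and $P_n^{H}(\omega)=(2^nn!)^{-1/2}H_n(\omega)$, so that $\int_{-\infty}^{\infty}P_n^{H}(\omega)P_m^{H}(\omega)e^{-\omega^2}\frac{d\omega}{\sqrt{\pi}}=\delta(n-m)$. Let $\mathcal{K}^n=i^{-n}P_n^{H}\!\left(i\frac{d}{dt}\right)$ be the associated linear differential operators (each $\omega^k$ in $P_n^H(\omega)$ is replaced by $i^k\frac{d^k}{dt^k}$ and the result multiplied by $i^{-n}$); they have real coefficients and $\mathcal{K}^n_t[e^{i\omega t}]=i^nP_n^{H}(\omega)e^{i\omega t}$. $\mathcal{C}^{H}$ consists of the real functions $f$ on $\mathbb{R}$ which are restrictions of entire functions and for which the sequence $\nu_n^f(t)=\frac{1}{\sqrt{n+1}}\sum_{k=0}^n\mathcal{K}^k[f](t)^2$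 converges uniformly on every finite interval. $\mathcal{C}_2^{H}$ is $\mathcal{C}^H$ modulo the functions with $\lim_{n}\nu_n^f(t)=0$, with scalar product $$\langle f,g\rangle^{H}=\lim_{n\to\infty}\frac{1}{\sqrt{n+1}}\sum_{k=0}^{n}\mathcal{K}^k[f](t)\,\mathcal{K}^k[g](t)$$ (the value being independent of $t\in\mathbb{R}$) and norm $\|f\|=\sqrt{\langle f,f\rangle^{H}}$. *)

theory Defs
  imports "HOL-Analysis.Analysis" "HOL-Computational_Algebra.Polynomial"
begin

section \<open>Hermite polynomials\<close>

fun hermite :: "nat \<Rightarrow> real poly" where
  "hermite 0 = 1"
| "hermite (Suc 0) = [:0, 2:]"
| "hermite (Suc (Suc n)) = [:0, 2:] * hermite (Suc n) - smult (2 * real (Suc n)) (hermite n)"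

lemma pderiv_hermite_Suc: "pderiv (hermite (Suc n)) = smult (2 * real (Suc n)) (hermite n)"
proof (induction n rule: hermite.induct)
  case (3 n)
  let ?X = "[:0, 2:] :: real poly" and ?c = "real (Suc n)"
  have dX: "pderiv ?X = [:2:]" by (simp add: pderiv_pCons)
  have "pderiv (hermite (Suc (Suc (Suc n)))) =
      ?X * pderiv (hermite (Suc (Suc n))) + hermite (Suc (Suc n)) * pderiv ?X
      - smult (2 * real (Suc (Suc n))) (pderiv (hermite (Suc n)))"
    by (simp only: hermite.simps(3)[of "Suc n"] pderiv_diff pderiv_mult pderiv_smult)
  also have "\<dots> = smult (2 * real (Suc (Suc n))) (?X * hermite (Suc n) - smult (2 * ?c) (hermite n))
      + smult 2 (hermite (Suc (Suc n)))"
    by (simp only: 3 dX) (simp add: smult_diff_right)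
  also have "\<dots> = smult (2 * real (Suc (Suc n)) + 2) (hermite (Suc (Suc n)))"
    by (simp only: hermite.simps(3)[of n] smult_add_left)
  finally show ?case by (simp add: algebra_simps)
qed (simp_all add: pderiv_pCons one_pCons)

lemma hermite_Suc: "hermite (Suc n) = [:0, 2:] * hermite n - pderiv (hermite n)"
  by (cases n) (simp_all only: hermite.simps pderiv_hermite_Suc, simp_all)

text \<open>The Rodrigues formula identifies these as the physicists' Hermite polynomials.\<close>

lemma hermite_rodrigues:
  "poly (hermite n) x = (-1) ^ n * exp (x\<^sup>2) * (deriv ^^ n) (\<lambda>y. exp (- y\<^sup>2)) x"
proof -
  have "(deriv ^^ n) (\<lambda>y. exp (- y\<^sup>2)) = (\<lambda>y. (-1) ^ n * poly (hermite n) y * exp (- y\<^sup>2))"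
  proof (induction n)
    case (Suc n)
    have "deriv (\<lambda>y. (-1) ^ n * poly (hermite n) y * exp (- y\<^sup>2)) y =
        (-1) ^ Suc n * poly (hermite (Suc n)) y * exp (- y\<^sup>2)" for y :: real
      unfolding hermite_Suc
      by (rule DERIV_imp_deriv)
        (auto intro!: derivative_eq_intros poly_DERIV simp: algebra_simps)
    then have eq: "deriv (\<lambda>y. (-1) ^ n * poly (hermite n) y * exp (- y\<^sup>2)) =
        (\<lambda>y. (-1) ^ Suc n * poly (hermite (Suc n)) y * exp (- y\<^sup>2))"
      by (rule ext)
    show ?case by (simp only: funpow.simps o_apply Suc eq)
  qed simp
  then have "(-1) ^ n * exp (x\<^sup>2) * (deriv ^^ n) (\<lambda>y. exp (- y\<^sup>2)) x =
      ((-1) ^ n * (-1) ^ n) * (exp (x\<^sup>2) * exp (- x\<^sup>2)) * poly (hermite n) x"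
    by (simp only: mult_ac)
  also have "\<dots> = poly (hermite n) x"
    by (simp flip: power_mult_distrib exp_add)
  finally show ?thesis ..
qed

lemma coeff_hermite_parity: "odd (n + k) \<Longrightarrow> coeff (hermite n) k = 0"
proof (induction n arbitrary: k rule: hermite.induct)
  case (3 n)
  then show ?case by (cases k) (auto simp: coeff_pCons)
next
  case 1
  then show ?case by (cases k) (auto simp: coeff_pCons one_pCons)
next
  case 2
  then show ?case by (auto simp: coeff_pCons split: nat.splits)
qed

definition hermite_norm :: "nat \<Rightarrow> real poly" where
  "hermite_norm n = smult (1 / sqrt (2 ^ n * fact n)) (hermite n)"


section \<open>The associated differential operators\<close>

text \<open>\<open>cderiv_complex n f t\<close> is \<open>i\<^sup>-\<^sup>n P\<^sub>n(i d/dt) f\<close> at \<open>t\<close>, read coefficientwise as a complex number;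
  by parity it is real for real \<open>f\<close> (lemma \<open>of_real_cderiv\<close>), so taking the real part in \<open>cderiv\<close>
  only changes the type.\<close>

definition cderiv_complex :: "nat \<Rightarrow> (real \<Rightarrow> real) \<Rightarrow> real \<Rightarrow> complex" where
  "cderiv_complex n f t = (1 / \<i> ^ n) *
     (\<Sum>k\<le>degree (hermite_norm n).
        of_real (coeff (hermite_norm n) k) * (\<i> ^ k * of_real ((deriv ^^ k) f t)))"

definition cderiv :: "nat \<Rightarrow> (real \<Rightarrow> real) \<Rightarrow> real \<Rightarrow> real" where
  "cderiv n f t = Re (cderiv_complex n f t)"

lemma of_real_cderiv: "complex_of_real (cderiv n f t) = cderiv_complex n f t"
proof -
  have "of_real (coeff (hermite_norm n) k) * (\<i> ^ k / \<i> ^ n) \<in> \<real>" for k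
  proof (cases "even (n + k)")
    case False
    then show ?thesis by (simp add: hermite_norm_def coeff_hermite_parity)
  next
    case True
    have "\<i> ^ k / \<i> ^ n = \<i> ^ (k + n) / (\<i> ^ n * \<i> ^ n)"
      by (simp add: power_add)
    also have "\<dots> = \<i> ^ (n + k) / (-1) ^ n"
      by (simp add: add.commute flip: power_mult_distrib)
    also obtain m where "n + k = 2 * m" using True unfolding dvd_def by blast
    then have "\<i> ^ (n + k) / (-1) ^ n = of_real ((-1) ^ m / (-1) ^ n)"
      by (simp add: power_mult)
    finally show ?thesis by (metis Reals_mult Reals_of_real)
  qed
  then have "of_real (coeff (hermite_norm n) k) * (\<i> ^ k / \<i> ^ n) * of_real ((deriv ^^ k) f t) \<in> \<real>" for k
    by (rule Reals_mult[OF _ Reals_of_real])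
  then have "cderiv_complex n f t \<in> \<real>"
    unfolding cderiv_complex_def sum_distrib_left
    by (intro sum_in_Reals) (metis (no_types, lifting) mult.assoc mult.commute mult_1 times_divide_eq_left)
  then show ?thesis by (simp add: cderiv_def)
qed


section \<open>The spaces \<open>C\<^sup>H\<close> and \<open>C\<^sub>2\<^sup>H\<close>\<close>

definition H_pairing_seq :: "(real \<Rightarrow> real) \<Rightarrow> (real \<Rightarrow> real) \<Rightarrow> real \<Rightarrow> nat \<Rightarrow> real" where
  "H_pairing_seq f g t n = (1 / sqrt (real (n + 1))) * (\<Sum>k=0..n. cderiv k f t * cderiv k g t)"

definition nu :: "(real \<Rightarrow> real) \<Rightarrow> nat \<Rightarrow> real \<Rightarrow> real" where
  "nu f n t = (1 / sqrt (real (n + 1))) * (\<Sum>k=0..n. (cderiv k f t)\<^sup>2)"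

definition CH :: "(real \<Rightarrow> real) set" where
  "CH = {f. (\<exists>F :: complex \<Rightarrow> complex. F holomorphic_on UNIV \<and>
               (\<forall>t. F (complex_of_real t) = complex_of_real (f t))) \<and>
            (\<forall>a b. uniformly_convergent_on {a..b} (nu f))}"

definition null_rel :: "((real \<Rightarrow> real) \<times> (real \<Rightarrow> real)) set" where
  "null_rel = {(f, g). f \<in> CH \<and> g \<in> CH \<and> (\<forall>t. (\<lambda>n. nu (\<lambda>s. f s - g s) n t) \<longlonglongrightarrow> 0)}"

definition C2H :: "(real \<Rightarrow> real) set set" where
  "C2H = CH // null_rel"

definition C2H_class :: "(real \<Rightarrow> real) \<Rightarrow> (real \<Rightarrow> real) set" where
  "C2H_class f = null_rel `` {f}"

text \<open>The limit is required to be the same at every point and for all representatives;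
  the value is unspecified for classes where this fails.\<close>

definition C2H_inner :: "(real \<Rightarrow> real) set \<Rightarrow> (real \<Rightarrow> real) set \<Rightarrow> real" where
  "C2H_inner A B = (THE c. \<forall>f\<in>A. \<forall>g\<in>B. \<forall>t. H_pairing_seq f g t \<longlonglongrightarrow> c)"

definition C2H_norm :: "(real \<Rightarrow> real) set \<Rightarrow> real" where
  "C2H_norm A = sqrt (C2H_inner A A)"

definition sin_fun :: "real \<Rightarrow> real \<Rightarrow> real" where
  "sin_fun \<omega> = (\<lambda>t. sin (\<omega> * t))"

definition cos_fun :: "real \<Rightarrow> real \<Rightarrow> real" where
  "cos_fun \<omega> = (\<lambda>t. cos (\<omega> * t))"

definition trig_family :: "(real \<Rightarrow> real) set" where
  "trig_family = sin_fun ` {0<..} \<union> cos_fun ` {0<..}"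

end

(* On a wave t \<mapsto> Re (c * exp (i \<omega> t)) the n-th operator acts as multiplication of c by i^n P_n(\<omega>),
   so the pairing of two waves with frequencies \<omega>, \<sigma> is a combination, with coefficients bounded in t,
   of the Christoffel-Darboux kernels K_n(\<omega>, \<sigma>) and K_n(\<omega>, -\<sigma>), where K_n(x, y) = sum of
   P_k(x) P_k(y) over k \<le> n, divided by sqrt (n + 1). Off the diagonal the Christoffel-Darboux
   formula and P_n(x) \<rightarrow> 0, which follows from the monotonicity of Sonin's energy, make this tend to 0.
   On the diagonal, exp (-x^2) K_n(x, x) has derivative
   - sqrt (2 (n + 1)) exp (-x^2) P_n(x) P_{n+1}(x) = o(sqrt n), so the limit at x is exp (x^2) times
   the limit at 0, and the latter is given by the Wallis product. *)

theory Submission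
  imports Defs "HOL-Complex_Analysis.Complex_Analysis"
begin

section \<open>Normalized Hermite polynomials: recurrence, derivative, parity\<close>

definition hp :: "nat \<Rightarrow> real \<Rightarrow> real" where
  "hp n x = poly (hermite_norm n) x"

lemma hp_0 [simp]: "hp 0 x = 1"
  by (simp add: hp_def hermite_norm_def)

lemma hp_1: "sqrt 2 * hp (Suc 0) x = 2 * x"
  by (simp add: hp_def hermite_norm_def)

lemma sqrt_norm_Suc:
  "sqrt (2 ^ Suc n * fact (Suc n)) = sqrt (2 * real (Suc n)) * sqrt (2 ^ n * fact n)"
proof -
  have "2 ^ Suc n * fact (Suc n) = 2 * real (Suc n) * (2 ^ n * fact n)" by simp
  then show ?thesis by (simp only: real_sqrt_mult)
qed

text \<open>The recurrence of \<open>hermite\<close> is divided by the normalizing constant of index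
  n + 1. This leaves a factor sqrt (2 (n + 2)) on the left, and on the right one of the two factors
  sqrt (2 (n + 1)) of 2 (n + 1) goes into the normalization of \<open>hp n\<close>.\<close>

lemma hp_rec:
  "sqrt (2 * real (Suc (Suc n))) * hp (Suc (Suc n)) x
    = 2 * x * hp (Suc n) x - sqrt (2 * real (Suc n)) * hp n x"
proof -
  define a where "a = (\<lambda>n. sqrt (2 ^ n * fact n) :: real)"
  have a: "a (Suc n) = sqrt (2 * real (Suc n)) * a n" for n
    unfolding a_def by (rule sqrt_norm_Suc)
  have pos: "a n > 0" for n by (simp add: a_def)
  have hp: "hp n x = poly (hermite n) x / a n" for n
    by (simp add: hp_def hermite_norm_def a_def)
  define s where "s = sqrt (2 * real (Suc n))"
  have s: "s > 0" "s * s = 2 * real (Suc n)" by (simp_all add: s_def)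
  have "sqrt (2 * real (Suc (Suc n))) * hp (Suc (Suc n)) x = poly (hermite (Suc (Suc n))) x / a (Suc n)"
    unfolding hp a[of "Suc n"] using pos[of "Suc n"] by simp
  also have "\<dots> = 2 * x * hp (Suc n) x - s * s * poly (hermite n) x / a (Suc n)"
    unfolding s(2) by (simp add: hp diff_divide_distrib)
  also have "s * s * poly (hermite n) x / a (Suc n) = s * hp n x"
    unfolding hp a s_def[symmetric] using pos[of n] s(1) by (simp add: mult.assoc)
  finally show ?thesis by (simp add: s_def)
qed

lemma hp_deriv_0: "(hp 0 has_field_derivative 0) (at x)"
  by (simp add: hp_0[abs_def])

lemma hp_deriv: "(hp (Suc n) has_field_derivative sqrt (2 * real (Suc n)) * hp n x) (at x)"
proof -
  have "(hp (Suc n) has_field_derivative poly (pderiv (hermite_norm (Suc n))) x) (at x)"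
    unfolding hp_def[abs_def] by (rule poly_DERIV)
  moreover have "poly (pderiv (hermite_norm (Suc n))) x = sqrt (2 * real (Suc n)) * hp n x"
  proof -
    define s where "s = sqrt (2 * real (Suc n))"
    have s: "s > 0" "2 * real (Suc n) = s * s" by (simp_all add: s_def)
    show ?thesis
      unfolding hp_def hermite_norm_def pderiv_smult pderiv_hermite_Suc sqrt_norm_Suc
      unfolding s_def[symmetric] unfolding s(2) using s(1) by simp
  qed
  ultimately show ?thesis by simp
qed

lemma hp_uminus: "hp n (- x) = (- 1) ^ n * hp n x"
proof (induction n rule: hermite.induct)
  case (3 n)
  have "sqrt (2 * real (Suc (Suc n))) * hp (Suc (Suc n)) (- x) =
      sqrt (2 * real (Suc (Suc n))) * ((- 1) ^ Suc (Suc n) * hp (Suc (Suc n)) x)"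
    unfolding hp_rec mult.left_commute[of "sqrt (2 * real (Suc (Suc n)))"] 3
    by (simp add: algebra_simps)
  then show ?case by simp
next
  case 2
  \<comment> \<open>The sum of the two instances of \<open>hp_1\<close> says that sqrt 2 times
    \<open>hp (Suc 0) x + hp (Suc 0) (- x)\<close> is 2 x - 2 x = 0.\<close>
  then show ?case
    using arg_cong2[OF hp_1[of x] hp_1[of "-x"], of "(+)"] by (simp flip: distrib_left)
qed simp

section \<open>The Christoffel--Darboux kernel\<close>

definition hkernel :: "nat \<Rightarrow> real \<Rightarrow> real \<Rightarrow> real" where
  "hkernel n x y = (\<Sum>k=0..n. hp k x * hp k y)"

lemma kernel_0 [simp]: "hkernel 0 x y = 1"
  by (simp add: hkernel_def)

lemma kernel_Suc: "hkernel (Suc n) x y = hkernel n x y + hp (Suc n) x * hp (Suc n) y"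
  by (simp add: hkernel_def)

text \<open>Induction on n: by the recurrence, raising n by one adds to the right-hand side exactly
  2 (x - y) times the new summand of the kernel.\<close>

lemma christoffel_darboux:
  "2 * (x - y) * hkernel n x y
    = sqrt (2 * real (Suc n)) * (hp (Suc n) x * hp n y - hp n x * hp (Suc n) y)"
proof (induction n)
  case 0
  show ?case using hp_1[of x] hp_1[of y] by (simp add: algebra_simps)
next
  case (Suc n)
  define s r where "s = sqrt (2 * real (Suc n))" and "r = sqrt (2 * real (Suc (Suc n)))"
  have rec: "r * hp (Suc (Suc n)) z = 2 * z * hp (Suc n) z - s * hp n z" for z
    unfolding s_def r_def by (rule hp_rec)
  have "r * (hp (Suc (Suc n)) x * hp (Suc n) y - hp (Suc n) x * hp (Suc (Suc n)) y)
    = (r * hp (Suc (Suc n)) x) * hp (Suc n) y - hp (Suc n) x * (r * hp (Suc (Suc n)) y)"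
    by (simp add: algebra_simps)
  also have "\<dots> = 2 * (x - y) * (hp (Suc n) x * hp (Suc n) y)
      + s * (hp (Suc n) x * hp n y - hp n x * hp (Suc n) y)"
    unfolding rec by (simp add: algebra_simps)
  finally show ?case using Suc.IH
    unfolding kernel_Suc s_def[symmetric] r_def[symmetric] by (simp add: algebra_simps)
qed

text \<open>In the induction step the new square contributes twice s P_n P_{n+1} to the derivative,
  which flips the sign of the old last term. The recurrence for r P_{n+2} rewrites the flipped term
  as the new last term plus 2 x times the new square.\<close>

lemma kernel_diag_deriv:
  "((\<lambda>x. hkernel n x x) has_field_derivative
     2 * x * hkernel n x x - sqrt (2 * real (Suc n)) * hp n x * hp (Suc n) x) (at x)"
proof (induction n)
  case 0
  show ?case using hp_1[of x] by simp
next
  case (Suc n)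
  define s r where "s = sqrt (2 * real (Suc n))" and "r = sqrt (2 * real (Suc (Suc n)))"
  have rec: "r * hp (Suc (Suc n)) x = 2 * x * hp (Suc n) x - s * hp n x"
    unfolding s_def r_def by (rule hp_rec)
  have "r * hp (Suc n) x * hp (Suc (Suc n)) x = hp (Suc n) x * (2 * x * hp (Suc n) x - s * hp n x)"
    unfolding rec[symmetric] by simp
  with Suc show ?case
    unfolding kernel_Suc s_def[symmetric] r_def[symmetric]
    by (auto intro!: derivative_eq_intros DERIV_cong[OF hp_deriv] simp: s_def algebra_simps)
qed

text \<open>The weight cancels the term 2 x K_n of \<open>kernel_diag_deriv\<close>; only a product
  of two consecutive polynomials survives, and these tend to 0.\<close>

lemma weighted_kernel_deriv:
  "((\<lambda>x. exp (- x\<^sup>2) * hkernel n x x) has_field_derivative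
     - sqrt (2 * real (Suc n)) * (exp (- x\<^sup>2) * (hp n x * hp (Suc n) x))) (at x)"
  by (rule derivative_eq_intros kernel_diag_deriv refl)+ (simp add: algebra_simps)

section \<open>Values at the origin\<close>

lemma hp_zero_rec: "(hp (Suc (Suc n)) 0)\<^sup>2 = real (Suc n) / real (Suc (Suc n)) * (hp n 0)\<^sup>2"
proof -
  have "(sqrt (2 * real (Suc (Suc n))) * hp (Suc (Suc n)) 0)\<^sup>2 = (sqrt (2 * real (Suc n)) * hp n 0)\<^sup>2"
    unfolding hp_rec by simp
  then have "2 * real (Suc (Suc n)) * (hp (Suc (Suc n)) 0)\<^sup>2 = 2 * real (Suc n) * (hp n 0)\<^sup>2"
    by (simp only: power_mult_distrib real_sqrt_pow2_iff) simp
  then show ?thesis by (simp add: field_simps)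
qed

lemma hp_zero_odd: "hp (Suc (2 * m)) 0 = 0"
  using hp_uminus[of "Suc (2 * m)" 0] by simp

text \<open>By \<open>hp_zero_rec\<close>, P_{2m}(0)^2 is the product of (2k - 1) / (2k) over k
  \<le> m. Its square times 2m + 1 is the product of (2k - 1) (2k + 1) / (4 k^2), the reciprocal of
  the Wallis product.\<close>

lemma hp_zero_even:
  "((hp (2 * m) 0)\<^sup>2)\<^sup>2 * real (2 * m + 1) = inverse (\<Prod>k=1..m. (4 * (real k)\<^sup>2) / (4 * (real k)\<^sup>2 - 1))"
proof (induction m)
  case (Suc m)
  define q where "q = ((hp (2 * m) 0)\<^sup>2)\<^sup>2"
  define M where "M = real m"
  have M: "M \<ge> 0" by (simp add: M_def)
  have pos: "4 * (M + 1)\<^sup>2 - 1 = (2 * M + 1) * (2 * M + 3)"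
    by (simp add: power2_eq_square algebra_simps)
  have "((hp (2 * Suc m) 0)\<^sup>2)\<^sup>2 * real (2 * Suc m + 1) = ((2 * M + 1) / (2 * M + 2))\<^sup>2 * q * (2 * M + 3)"
    using hp_zero_rec[of "2 * m"]
    by (simp only: mult_Suc_right add_2_eq_Suc power_mult_distrib q_def M_def) (simp add: algebra_simps)
  also have "\<dots> = q * (2 * M + 1) * ((4 * (M + 1)\<^sup>2 - 1) / (4 * (M + 1)\<^sup>2))"
    unfolding pos using M by (simp add: power2_eq_square divide_simps) (simp add: algebra_simps)
  also have "q * (2 * M + 1) = inverse (\<Prod>k=1..m. (4 * (real k)\<^sup>2) / (4 * (real k)\<^sup>2 - 1))"
    using Suc by (simp add: q_def M_def add.commute)
  also have "(4 * (M + 1)\<^sup>2 - 1) / (4 * (M + 1)\<^sup>2)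
      = inverse (4 * (real (Suc m))\<^sup>2 / (4 * (real (Suc m))\<^sup>2 - 1))"
    by (simp add: M_def add.commute)
  also have "inverse (\<Prod>k=1..m. 4 * (real k)\<^sup>2 / (4 * (real k)\<^sup>2 - 1)) * \<dots>
      = inverse (\<Prod>k=1..Suc m. 4 * (real k)\<^sup>2 / (4 * (real k)\<^sup>2 - 1))"
    unfolding inverse_mult_distrib[symmetric] by (subst prod.nat_ivl_Suc') (simp_all add: mult.commute)
  finally show ?case .
qed simp

text \<open>Odd indices contribute nothing. The sum over even ones has a closed form because (2m +
  1) (1 + 1 / (2m + 2)) = (2m + 3) (2m + 1) / (2m + 2), where the last fraction is the ratio of
  consecutive even terms.\<close>

lemma kernel_zero_even: "hkernel (2 * m) 0 0 = real (2 * m + 1) * (hp (2 * m) 0)\<^sup>2"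
proof (induction m)
  case (Suc m)
  have "hkernel (2 * Suc m) 0 0 = hkernel (2 * m) 0 0 + (hp (Suc (Suc (2 * m))) 0)\<^sup>2"
    by (simp add: kernel_Suc hp_zero_odd power2_eq_square)
  then show ?case
    using hp_zero_rec[of "2 * m"] Suc by (simp add: field_simps)
qed simp

lemma kernel_zero_odd: "hkernel (Suc (2 * m)) 0 0 = hkernel (2 * m) 0 0"
  by (simp add: kernel_Suc hp_zero_odd)

lemma filterlim_parity:
  fixes f :: "nat \<Rightarrow> real"
  assumes "(\<lambda>m. f (2 * m)) \<longlonglongrightarrow> l" "(\<lambda>m. f (Suc (2 * m))) \<longlonglongrightarrow> l"
  shows "f \<longlonglongrightarrow> l"
proof (rule tendstoI)
  fix e :: real assume "e > 0"
  then obtain N M where N: "\<And>m. m \<ge> N \<Longrightarrow> dist (f (2 * m)) l < e"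
    and M: "\<And>m. m \<ge> M \<Longrightarrow> dist (f (Suc (2 * m))) l < e"
    using assms unfolding lim_sequentially by meson
  have "dist (f n) l < e" if "n \<ge> Suc (2 * (N + M))" for n
  proof (cases "even n")
    case True
    then obtain m where "n = 2 * m" by blast
    then show ?thesis using N[of m] that by simp
  next
    case False
    then obtain m where "n = Suc (2 * m)" by (metis oddE Suc_eq_plus1)
    then show ?thesis using M[of m] that by simp
  qed
  then show "\<forall>\<^sub>F n in sequentially. dist (f n) l < e"
    unfolding eventually_sequentially by blast
qed

lemma hp_zero_even_lim: "(\<lambda>m. ((hp (2 * m) 0)\<^sup>2)\<^sup>2 * real (2 * m + 1)) \<longlonglongrightarrow> 2 / pi"
  unfolding hp_zero_even using tendsto_inverse[OF wallis] by simp

lemma hp_zero_lim: "(\<lambda>n. (hp n 0)\<^sup>2) \<longlonglongrightarrow> 0"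
proof (rule filterlim_parity)
  have "(\<lambda>m. inverse (real (2 * m + 1))) \<longlonglongrightarrow> 0"
    by real_asymp
  from tendsto_mult[OF hp_zero_even_lim this]
  have "(\<lambda>m. ((hp (2 * m) 0)\<^sup>2)\<^sup>2) \<longlonglongrightarrow> 0"
    by (simp add: mult.assoc del: of_nat_Suc)
  then show "(\<lambda>m. (hp (2 * m) 0)\<^sup>2) \<longlonglongrightarrow> 0"
    by (subst (asm) power_tendsto_0_iff) auto
qed (simp add: hp_zero_odd)

lemma kernel_zero_lim: "(\<lambda>n. hkernel n 0 0 / sqrt (real (n + 1))) \<longlonglongrightarrow> sqrt (2 / pi)"
proof (rule filterlim_parity)
  \<comment> \<open>The closed form is rewritten so that the quantity with Wallis limit 2 / pi
    stands under the first root.\<close>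
  have eq: "hkernel (2 * m) 0 0 = sqrt (((hp (2 * m) 0)\<^sup>2)\<^sup>2 * real (2 * m + 1)) * sqrt (real (2 * m + 1))" for m
  proof -
    have "sqrt (real (2 * m + 1)) * sqrt (real (2 * m + 1)) = real (2 * m + 1)" by simp
    then show ?thesis unfolding kernel_zero_even real_sqrt_mult real_sqrt_abs
      by (simp only: mult.assoc abs_power2) (simp add: mult.commute)
  qed
  have "(\<lambda>m. sqrt (((hp (2 * m) 0)\<^sup>2)\<^sup>2 * real (2 * m + 1))) \<longlonglongrightarrow> sqrt (2 / pi)"
    by (intro tendsto_real_sqrt hp_zero_even_lim)
  moreover have "sqrt (((hp (2 * m) 0)\<^sup>2)\<^sup>2 * real (2 * m + 1)) = hkernel (2 * m) 0 0 / sqrt (real (2 * m + 1))" for m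
    unfolding eq by (simp add: field_simps)
  ultimately show even: "(\<lambda>m. hkernel (2 * m) 0 0 / sqrt (real (2 * m + 1))) \<longlonglongrightarrow> sqrt (2 / pi)"
    by simp
  \<comment> \<open>For odd index the kernel equals the preceding one; only the normalization
    changes, by a factor tending to 1.\<close>
  have "(\<lambda>m. sqrt (real (2 * m + 1)) / sqrt (real (Suc (2 * m) + 1))) \<longlonglongrightarrow> 1"
    by real_asymp
  from tendsto_mult[OF even this]
  show "(\<lambda>m. hkernel (Suc (2 * m)) 0 0 / sqrt (real (Suc (2 * m) + 1))) \<longlonglongrightarrow> sqrt (2 / pi)"
    by (simp add: kernel_zero_odd)
qed

section \<open>Decay of the normalized Hermite polynomials\<close>

text \<open>Sonin's energy of the Hermite function \<open>u = exp (- x\<^sup>2 / 2) P\<close>, which solves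
  \<open>u'' + (2 * n + 3 - x\<^sup>2) * u = 0\<close> (here \<open>n + 1\<close> is the index of \<open>P\<close>).\<close>

definition energy :: "nat \<Rightarrow> real \<Rightarrow> real" where
  "energy n x = exp (- x\<^sup>2) * ((2 * real n + 3 - x\<^sup>2) * (hp (Suc n) x)\<^sup>2
     + (sqrt (2 * real (Suc n)) * hp n x - x * hp (Suc n) x)\<^sup>2)"

text \<open>This is Hermite's equation for P_{n+1} in first-order form: by \<open>hp_deriv\<close>
  the function differentiated here is already the derivative of P_{n+1}.\<close>

lemma hp_second_deriv:
  "((\<lambda>x. sqrt (2 * real (Suc n)) * hp n x) has_field_derivative
     2 * x * (sqrt (2 * real (Suc n)) * hp n x) - 2 * real (Suc n) * hp (Suc n) x) (at x)"
proof (cases n)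
  case 0
  have "2 * x * sqrt 2 = 2 * hp (Suc 0) x"
    unfolding hp_1[of x, symmetric] by simp
  with 0 show ?thesis
    by (auto intro!: derivative_eq_intros hp_deriv_0)
next
  case (Suc m)
  define s r where "s = sqrt (2 * real (Suc m))" and "r = sqrt (2 * real (Suc (Suc m)))"
  have r: "2 * real (Suc (Suc m)) = r * r" by (simp add: r_def)
  have "r * r * hp (Suc (Suc m)) x = r * (2 * x * hp (Suc m) x - s * hp m x)"
    unfolding r_def s_def hp_rec[symmetric] by simp
  then have "2 * x * (r * hp (Suc m) x) - 2 * real (Suc (Suc m)) * hp (Suc (Suc m)) x = r * (s * hp m x)"
    unfolding r by (simp add: algebra_simps)
  with hp_deriv[of m x] show ?thesis
    unfolding Suc r_def[symmetric] s_def[symmetric] by (auto intro: DERIV_cmult)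
qed

text \<open>With u the Hermite function, the energy is (2n + 3 - x^2) u^2 + u'^2. The differential
  equation cancels all terms with u u', so only the derivative -2x of the coefficient acts, on
  u^2.\<close>

lemma energy_deriv:
  "(energy n has_field_derivative - 2 * x * exp (- x\<^sup>2) * (hp (Suc n) x)\<^sup>2) (at x)"
proof -
  define q where "q = (\<lambda>x. sqrt (2 * real (Suc n)) * hp n x)"
  have q: "(q has_field_derivative 2 * x * q x - 2 * real (Suc n) * hp (Suc n) x) (at x)"
    unfolding q_def by (rule hp_second_deriv)
  have p: "(hp (Suc n) has_field_derivative q x) (at x)"
    unfolding q_def by (rule hp_deriv)
  have "((\<lambda>x. exp (- x\<^sup>2) * ((2 * real n + 3 - x\<^sup>2) * (hp (Suc n) x)\<^sup>2
     + (q x - x * hp (Suc n) x)\<^sup>2)) has_field_derivative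
       - 2 * x * exp (- x\<^sup>2) * (hp (Suc n) x)\<^sup>2) (at x)"
    by (rule derivative_eq_intros q p refl)+ (simp add: power2_eq_square algebra_simps)
  then show ?thesis unfolding energy_def[abs_def] q_def .
qed

lemma energy_le_zero:
  assumes "0 \<le> x"
  shows "energy n x \<le> energy n 0"
  by (rule DERIV_nonpos_imp_nonincreasing[OF assms])
    (use energy_deriv in \<open>force intro!: exI mult_nonneg_nonneg\<close>)

text \<open>For x^2 \<le> n the coefficient 2n + 3 - x^2 is at least half of 2n + 3, while the
  energy at 0 is at most 2n + 3 times the sum of the two squares there. Dividing gives the constant
  2.\<close>

lemma hp_bound:
  assumes "0 \<le> x" "x\<^sup>2 \<le> real n"
  shows "exp (- x\<^sup>2) * (hp (Suc n) x)\<^sup>2 \<le> 2 * ((hp (Suc n) 0)\<^sup>2 + (hp n 0)\<^sup>2)"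
proof -
  define a where "a = exp (- x\<^sup>2) * (hp (Suc n) x)\<^sup>2"
  define b where "b = (hp (Suc n) 0)\<^sup>2 + (hp n 0)\<^sup>2"
  have [simp]: "a \<ge> 0" by (simp add: a_def)
  have "(real n + 3 / 2) * a \<le> (2 * real n + 3 - x\<^sup>2) * a"
    using assms by (intro mult_right_mono) auto
  also have "\<dots> \<le> energy n x"
    unfolding energy_def a_def by (simp add: algebra_simps)
  also have "\<dots> \<le> energy n 0" by (rule energy_le_zero[OF assms(1)])
  also have "\<dots> = (2 * real n + 3) * (hp (Suc n) 0)\<^sup>2 + 2 * real (Suc n) * (hp n 0)\<^sup>2"
    by (simp add: energy_def power_mult_distrib)
  also have "\<dots> \<le> (2 * real n + 3) * (hp (Suc n) 0)\<^sup>2 + (2 * real n + 3) * (hp n 0)\<^sup>2"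
    by (intro add_mono mult_right_mono) auto
  also have "\<dots> = (real n + 3 / 2) * (2 * b)" by (simp add: b_def algebra_simps)
  finally have "a \<le> 2 * b" by (subst (asm) mult_le_cancel_left_pos) auto
  then show ?thesis by (simp add: a_def b_def)
qed

text \<open>The right-hand side of \<open>hp_bound\<close>, reindexed to control
  \<open>hp n\<close>. It is independent of x, so it bounds the derivative of the weighted kernel on
  a whole interval.\<close>

definition hp_majorant :: "nat \<Rightarrow> real" where
  "hp_majorant n = 2 * ((hp n 0)\<^sup>2 + (hp (n - 1) 0)\<^sup>2)"

lemma hp_majorant_lim: "hp_majorant \<longlonglongrightarrow> 0"
proof -
  have "(\<lambda>n. (hp (n - 1) 0)\<^sup>2) \<longlonglongrightarrow> 0"
    by (subst filterlim_sequentially_Suc[symmetric]) (simp add: hp_zero_lim)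
  then have "(\<lambda>n. 2 * ((hp n 0)\<^sup>2 + (hp (n - 1) 0)\<^sup>2)) \<longlonglongrightarrow> 2 * (0 + 0)"
    by (intro tendsto_intros hp_zero_lim)
  then show ?thesis by (simp add: hp_majorant_def[abs_def])
qed

text \<open>The shift by 1 in the hypothesis matches the index n + 1 in \<open>hp_bound\<close> and
  excludes n = 0.\<close>

lemma hp_le_majorant:
  assumes "0 \<le> x" "x\<^sup>2 + 1 \<le> real n"
  shows "exp (- x\<^sup>2) * (hp n x)\<^sup>2 \<le> hp_majorant n"
proof (cases n)
  case 0
  then show ?thesis using assms(2) by (smt (verit) of_nat_0 zero_le_power2)
next
  case (Suc m)
  then show ?thesis using hp_bound[OF assms(1), of m] assms(2)
    by (simp add: hp_majorant_def)
qed

lemma hp_lim_nonneg: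
  assumes "0 \<le> x"
  shows "(\<lambda>n. hp n x) \<longlonglongrightarrow> 0"
proof -
  have "(\<lambda>n. exp (- x\<^sup>2) * (hp n x)\<^sup>2) \<longlonglongrightarrow> 0"
  proof (rule tendsto_sandwich[OF _ _ tendsto_const hp_majorant_lim])
    show "\<forall>\<^sub>F n in sequentially. exp (- x\<^sup>2) * (hp n x)\<^sup>2 \<le> hp_majorant n"
      using eventually_ge_at_top[of "nat \<lceil>x\<^sup>2 + 1\<rceil>"]
      by eventually_elim (rule hp_le_majorant[OF assms], linarith)
  qed simp
  from tendsto_mult_left[OF this, of "exp (x\<^sup>2)"]
  have "(\<lambda>n. (hp n x)\<^sup>2) \<longlonglongrightarrow> 0"
    by (simp add: mult.assoc[symmetric] exp_add[symmetric])
  then show ?thesis by (simp add: power_tendsto_0_iff)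
qed

lemma hp_lim: "(\<lambda>n. hp n x) \<longlonglongrightarrow> 0"
proof (cases "0 \<le> x")
  case False
  then have "(\<lambda>n. hp n (- x)) \<longlonglongrightarrow> 0" by (intro hp_lim_nonneg) simp
  then have "(\<lambda>n. \<bar>hp n (- x)\<bar>) \<longlonglongrightarrow> 0" by (rule tendsto_rabs_zero)
  then show ?thesis by (subst tendsto_rabs_zero_iff[symmetric]) (simp add: hp_uminus abs_mult)
qed (rule hp_lim_nonneg)

section \<open>Asymptotics of the kernel\<close>

text \<open>The factor sqrt (n + 1) in the Christoffel-Darboux formula is exactly the normalization,
  so the quotient is a fixed multiple of products of null sequences.\<close>

lemma kernel_offdiag_lim:
  assumes "x \<noteq> y"
  shows "(\<lambda>n. hkernel n x y / sqrt (real (n + 1))) \<longlonglongrightarrow> 0"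
proof -
  have eq: "hkernel n x y / sqrt (real (n + 1)) =
    sqrt 2 / (2 * (x - y)) * (hp (Suc n) x * hp n y - hp n x * hp (Suc n) y)" for n
  proof -
    have "2 * (x - y) * hkernel n x y
      = sqrt 2 * sqrt (real (n + 1)) * (hp (Suc n) x * hp n y - hp n x * hp (Suc n) y)"
      unfolding christoffel_darboux by (simp only: real_sqrt_mult Suc_eq_plus1)
    moreover have "sqrt (real (n + 1)) > 0" by simp
    ultimately show ?thesis using assms by (simp add: field_simps)
  qed
  have "(\<lambda>n. sqrt 2 / (2 * (x - y)) * (hp (Suc n) x * hp n y - hp n x * hp (Suc n) y))
      \<longlonglongrightarrow> sqrt 2 / (2 * (x - y)) * (0 * 0 - 0 * 0)"
    by (intro tendsto_intros hp_lim LIMSEQ_Suc)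
  then show ?thesis unfolding eq by simp
qed

text \<open>Mean value bound on [0, x]: the derivative from \<open>weighted_kernel_deriv\<close> is
  estimated by \<bar>a b\<bar> \<le> a^2 + b^2 and the majorant. The result is o(sqrt n) for fixed
  x, which allows comparison with the origin.\<close>

lemma weighted_kernel_variation:
  assumes "0 \<le> x" "x\<^sup>2 + 1 \<le> real n"
  shows "\<bar>exp (- x\<^sup>2) * hkernel n x x - hkernel n 0 0\<bar>
    \<le> sqrt (2 * real (Suc n)) * (hp_majorant n + hp_majorant (Suc n)) * x"
proof -
  have deriv_bound: "\<bar>- sqrt (2 * real (Suc n)) * (exp (- z\<^sup>2) * (hp n z * hp (Suc n) z))\<bar>
      \<le> sqrt (2 * real (Suc n)) * (hp_majorant n + hp_majorant (Suc n))" if "0 \<le> z" "z \<le> x" for z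
  proof -
    have "z\<^sup>2 \<le> x\<^sup>2" using that by (intro power_mono) auto
    then have "z\<^sup>2 + 1 \<le> real n" "z\<^sup>2 + 1 \<le> real (Suc n)" using assms(2) by simp_all
    then have m: "exp (- z\<^sup>2) * (hp n z)\<^sup>2 \<le> hp_majorant n"
      "exp (- z\<^sup>2) * (hp (Suc n) z)\<^sup>2 \<le> hp_majorant (Suc n)"
      using that(1) by (auto intro!: hp_le_majorant simp del: of_nat_Suc)
    have "\<bar>hp n z * hp (Suc n) z\<bar> \<le> (hp n z)\<^sup>2 + (hp (Suc n) z)\<^sup>2"
      using sum_squares_bound[of "\<bar>hp n z\<bar>" "\<bar>hp (Suc n) z\<bar>"]
      unfolding abs_mult power2_abs mult.assoc
      using mult_nonneg_nonneg[OF abs_ge_zero[of "hp n z"] abs_ge_zero[of "hp (Suc n) z"]] by linarith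
    then have "exp (- z\<^sup>2) * \<bar>hp n z * hp (Suc n) z\<bar> \<le> exp (- z\<^sup>2) * ((hp n z)\<^sup>2 + (hp (Suc n) z)\<^sup>2)"
      by (intro mult_left_mono) auto
    also have "\<dots> \<le> hp_majorant n + hp_majorant (Suc n)"
      using m by (simp add: algebra_simps)
    finally have "sqrt (2 * real (Suc n)) * (exp (- z\<^sup>2) * \<bar>hp n z * hp (Suc n) z\<bar>)
        \<le> sqrt (2 * real (Suc n)) * (hp_majorant n + hp_majorant (Suc n))"
      by (rule mult_left_mono) simp
    then show ?thesis
      by (simp only: abs_mult abs_minus_cancel abs_exp_cancel real_sqrt_abs2 abs_of_nonneg
        real_sqrt_ge_zero of_nat_0_le_iff mult_nonneg_nonneg zero_le_numeral)
  qed
  have "norm (exp (- x\<^sup>2) * hkernel n x x - exp (- 0\<^sup>2) * hkernel n 0 0)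
    \<le> sqrt (2 * real (Suc n)) * (hp_majorant n + hp_majorant (Suc n)) * norm (x - 0)"
  proof (rule field_differentiable_bound[OF convex_real_interval(5)])
    show "((\<lambda>x. exp (- x\<^sup>2) * hkernel n x x) has_field_derivative
        - sqrt (2 * real (Suc n)) * (exp (- z\<^sup>2) * (hp n z * hp (Suc n) z))) (at z within {0..x})" for z
      by (rule has_field_derivative_at_within[OF weighted_kernel_deriv])
    show "norm (- sqrt (2 * real (Suc n)) * (exp (- z\<^sup>2) * (hp n z * hp (Suc n) z)))
        \<le> sqrt (2 * real (Suc n)) * (hp_majorant n + hp_majorant (Suc n))" if "z \<in> {0..x}" for z
      unfolding real_norm_def by (rule deriv_bound) (use that in auto)
  qed (use assms in auto)
  then show ?thesis using assms by simp
qed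

lemma kernel_diag_lim:
  assumes "0 \<le> x"
  shows "(\<lambda>n. hkernel n x x / sqrt (real (n + 1))) \<longlonglongrightarrow> sqrt (2 / pi) * exp (x\<^sup>2)"
proof -
  define d where "d = (\<lambda>n. exp (- x\<^sup>2) * hkernel n x x / sqrt (real (n + 1)) - hkernel n 0 0 / sqrt (real (n + 1)))"
  have "d \<longlonglongrightarrow> 0"
  proof (rule Lim_null_comparison)
    have "norm (d n) \<le> sqrt 2 * (hp_majorant n + hp_majorant (Suc n)) * x"
      if n: "n \<ge> nat \<lceil>x\<^sup>2 + 1\<rceil>" for n
    proof -
      have "x\<^sup>2 + 1 \<le> real n" using n by linarith
      from weighted_kernel_variation[OF assms this]
      have "\<bar>exp (- x\<^sup>2) * hkernel n x x - hkernel n 0 0\<bar>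
        \<le> sqrt 2 * (hp_majorant n + hp_majorant (Suc n)) * x * sqrt (real (n + 1))"
        by (simp only: real_sqrt_mult Suc_eq_plus1 mult_ac)
      then show ?thesis
        by (simp add: d_def diff_divide_distrib[symmetric] divide_le_eq)
    qed
    then show "\<forall>\<^sub>F n in sequentially. norm (d n) \<le> sqrt 2 * (hp_majorant n + hp_majorant (Suc n)) * x"
      unfolding eventually_sequentially by blast
    have "(\<lambda>n. sqrt 2 * (hp_majorant n + hp_majorant (Suc n)) * x) \<longlonglongrightarrow> sqrt 2 * (0 + 0) * x"
      by (intro tendsto_intros hp_majorant_lim LIMSEQ_Suc)
    then show "(\<lambda>n. sqrt 2 * (hp_majorant n + hp_majorant (Suc n)) * x) \<longlonglongrightarrow> 0" by simp
  qed
  from tendsto_mult_left[OF tendsto_add[OF this kernel_zero_lim], of "exp (x\<^sup>2)"]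
  have "(\<lambda>n. exp (x\<^sup>2) * (exp (- x\<^sup>2) * hkernel n x x / sqrt (real (n + 1))))
      \<longlonglongrightarrow> exp (x\<^sup>2) * (0 + sqrt (2 / pi))"
    unfolding d_def by simp
  moreover have "exp (x\<^sup>2) * (exp (- x\<^sup>2) * k / s) = k / s" for k s
    by (simp add: exp_minus field_simps)
  ultimately show ?thesis
    by (simp only: add_0 mult.commute[of "exp (x\<^sup>2)" "sqrt (2 / pi)"])
qed

section \<open>Waves\<close>

text \<open>The complex amplitude c carries the phase: 1 gives the cosine and -\<i> the sine.
  Differentiation only multiplies c, so both families are treated at once.\<close>

definition wave :: "complex \<Rightarrow> real \<Rightarrow> real \<Rightarrow> real" where
  "wave c \<omega> t = Re (c * cis (\<omega> * t))"

lemma cos_fun_wave: "cos_fun \<omega> = wave 1 \<omega>"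
  by (simp add: fun_eq_iff cos_fun_def wave_def)

lemma sin_fun_wave: "sin_fun \<omega> = wave (- \<i>) \<omega>"
  by (simp add: fun_eq_iff sin_fun_def wave_def)

lemma deriv_wave: "deriv (wave c \<omega>) = wave (\<i> * of_real \<omega> * c) \<omega>"
proof
  fix t
  have "wave c \<omega> = (\<lambda>t. Re c * cos (\<omega> * t) - Im c * sin (\<omega> * t))"
    by (simp add: fun_eq_iff wave_def)
  moreover have "((\<lambda>t. Re c * cos (\<omega> * t) - Im c * sin (\<omega> * t)) has_field_derivative
      wave (\<i> * of_real \<omega> * c) \<omega> t) (at t)"
    by (rule derivative_eq_intros refl)+ (simp add: wave_def algebra_simps)
  ultimately show "deriv (wave c \<omega>) t = wave (\<i> * of_real \<omega> * c) \<omega> t"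
    by (simp add: DERIV_imp_deriv)
qed

lemma higher_deriv_wave: "(deriv ^^ k) (wave c \<omega>) = wave ((\<i> * of_real \<omega>) ^ k * c) \<omega>"
  by (induction k) (simp_all add: deriv_wave mult_ac)

lemma of_real_hp:
  "complex_of_real (hp n x) =
    (\<Sum>k\<le>degree (hermite_norm n). of_real (coeff (hermite_norm n) k) * of_real x ^ k)"
  by (simp add: hp_def poly_altdef)

text \<open>The wave is half the sum of z and its conjugate, with frequencies \<omega> and
  -\<omega>. On these \<i> d/dt acts as -\<omega> and \<omega>, so the polynomial is evaluated at
  both points and parity reduces the first value to the second.\<close>

lemma cderiv_wave: "cderiv n (wave c \<omega>) t = hp n \<omega> * Re (\<i> ^ n * (c * cis (\<omega> * t)))"
proof -
  define z where "z = c * cis (\<omega> * t)"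
  define p where "p = hermite_norm n"
  have re: "of_real (Re w) = (w + cnj w) / 2" for w
    by (simp add: complex_add_cnj)
  have deriv: "(deriv ^^ k) (wave c \<omega>) t = Re ((\<i> * of_real \<omega>) ^ k * z)" for k
    by (simp add: higher_deriv_wave wave_def z_def mult_ac)
  have term_eq: "\<i> ^ k * of_real ((deriv ^^ k) (wave c \<omega>) t) =
      (of_real (- \<omega>) ^ k * z + of_real \<omega> ^ k * cnj z) / 2" for k
  proof -
    have "\<i> ^ k * (\<i> * of_real \<omega>) ^ k = of_real (- \<omega>) ^ k"
      "\<i> ^ k * (- \<i> * of_real \<omega>) ^ k = of_real \<omega> ^ k"
      unfolding power_mult_distrib[symmetric] by (simp_all flip: mult.assoc)
    then show ?thesis
      unfolding deriv re complex_cnj_mult complex_cnj_power complex_cnj_i complex_cnj_complex_of_real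
      by (simp only: times_divide_eq_right distrib_left mult.assoc[symmetric])
  qed
  have "(\<Sum>k\<le>degree p. of_real (coeff p k) * (\<i> ^ k * of_real ((deriv ^^ k) (wave c \<omega>) t)))
      = (of_real (hp n (- \<omega>)) * z + of_real (hp n \<omega>) * cnj z) / 2"
    unfolding term_eq of_real_hp p_def[symmetric]
    by (simp add: sum_distrib_right sum_divide_distrib[symmetric] sum.distrib distrib_left mult.assoc)
  also have "\<dots> = of_real (hp n \<omega>) * (((- 1) ^ n * z + cnj z) / 2)"
    by (simp add: hp_uminus algebra_simps)
  finally have "cderiv_complex n (wave c \<omega>) t
      = of_real (hp n \<omega>) * (((1 / \<i> ^ n) * (- 1) ^ n * z + (1 / \<i> ^ n) * cnj z) / 2)"
    unfolding cderiv_complex_def p_def by (simp add: algebra_simps add_divide_distrib)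
  \<comment> \<open>After this rewriting the two halves become \<i>^n z and its conjugate, whose
    mean is a real part.\<close>
  also have "1 / \<i> ^ n = (- \<i>) ^ n"
    by (simp add: divide_eq_eq flip: power_mult_distrib)
  also have "(- \<i>) ^ n * (- 1) ^ n = \<i> ^ n"
    by (simp flip: power_mult_distrib)
  also have "(\<i> ^ n * z + (- \<i>) ^ n * cnj z) / 2 = of_real (Re (\<i> ^ n * z))"
    unfolding re by simp
  finally show ?thesis
    unfolding cderiv_def z_def by simp
qed

lemma wave_entire:
  "\<exists>F. F holomorphic_on UNIV \<and> (\<forall>t. F (complex_of_real t) = complex_of_real (wave c \<omega> t))"
proof (intro exI conjI allI)
  let ?F = "\<lambda>z. (c * exp (\<i> * of_real \<omega> * z) + cnj c * exp (- \<i> * of_real \<omega> * z)) / 2"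
  show "?F holomorphic_on UNIV" by (intro holomorphic_intros) auto
  show "?F (complex_of_real t) = complex_of_real (wave c \<omega> t)" for t
  proof -
    have "complex_of_real (wave c \<omega> t) = (c * cis (\<omega> * t) + cnj (c * cis (\<omega> * t))) / 2"
      unfolding wave_def complex_add_cnj by simp
    then show ?thesis by (simp add: cis_conv_exp exp_cnj mult_ac)
  qed
qed

section \<open>Pairings of waves and membership in \<open>CH\<close>\<close>

lemma Re_mult_Re: "Re z * Re w = (Re (z * cnj w) + Re (z * w)) / 2"
  by simp

lemma kernel_uminus: "hkernel n x (- y) = (\<Sum>k=0..n. (- 1) ^ k * (hp k x * hp k y))"
  by (simp add: hkernel_def hp_uminus mult_ac)

text \<open>Product-to-sum: the powers of \<i> cancel in the product with the conjugate and leave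
  (-1)^k in the product without it. By parity the alternating sum is the kernel at the reflected
  point -\<sigma>; t enters only through the bounded factors in front.\<close>

lemma H_pairing_seq_wave:
  "H_pairing_seq (wave c \<omega>) (wave d \<sigma>) t n =
     (Re (c * cnj d * cis ((\<omega> - \<sigma>) * t)) * (hkernel n \<omega> \<sigma> / sqrt (real (n + 1)))
    + Re (c * d * cis ((\<omega> + \<sigma>) * t)) * (hkernel n \<omega> (- \<sigma>) / sqrt (real (n + 1)))) / 2"
proof -
  define z w where "z = c * cis (\<omega> * t)" and "w = d * cis (\<sigma> * t)"
  have *: "Re (\<i> ^ k * z) * Re (\<i> ^ k * w) = (Re (z * cnj w) + (- 1) ^ k * Re (z * w)) / 2" for k
  proof -
    have "(\<i> ^ k * z) * cnj (\<i> ^ k * w) = z * cnj w"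
    proof -
      have "\<i> ^ k * (- \<i>) ^ k = 1" by (simp flip: power_mult_distrib)
      then show ?thesis
        by (simp only: complex_cnj_mult complex_cnj_power complex_cnj_i)
          (metis mult.left_commute mult.assoc mult_1)
    qed
    moreover have "(\<i> ^ k * z) * (\<i> ^ k * w) = of_real ((- 1) ^ k) * (z * w)"
    proof -
      have "\<i> ^ k * \<i> ^ k = (- 1) ^ k" by (simp flip: power_mult_distrib)
      then show ?thesis
        by (simp only: of_real_power of_real_minus of_real_1) (metis mult.left_commute mult.assoc)
    qed
    ultimately show ?thesis unfolding Re_mult_Re by (metis Re_complex_of_real times_complex.sel(1) Im_complex_of_real diff_zero mult_zero_left)
  qed
  have zw: "z * cnj w = c * cnj d * cis ((\<omega> - \<sigma>) * t)" "z * w = c * d * cis ((\<omega> + \<sigma>) * t)"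
    by (simp_all add: z_def w_def cis_cnj cis_mult mult_ac left_diff_distrib distrib_right)
       (simp_all add: mult.assoc[symmetric] cis_mult algebra_simps)
  have "(\<Sum>k=0..n. cderiv k (wave c \<omega>) t * cderiv k (wave d \<sigma>) t)
    = (\<Sum>k=0..n. hp k \<omega> * hp k \<sigma> * (Re (\<i> ^ k * z) * Re (\<i> ^ k * w)))"
    by (intro sum.cong) (simp_all only: cderiv_wave z_def w_def mult_ac)
  also have "\<dots> = (Re (z * cnj w) * hkernel n \<omega> \<sigma> + Re (z * w) * hkernel n \<omega> (- \<sigma>)) / 2"
    unfolding * kernel_uminus hkernel_def[of n \<omega> \<sigma>]
    by (simp only: sum_distrib_left sum.distrib[symmetric] sum_divide_distrib)
      (intro sum.cong, simp_all only: algebra_simps times_divide_eq_right)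
  finally show ?thesis
    unfolding H_pairing_seq_def zw by (simp add: add_divide_distrib)
qed

text \<open>Positivity of both frequencies also gives \<omega> \<noteq> -\<sigma>, so both kernels
  are off the diagonal.\<close>

lemma pairing_offdiag:
  assumes "\<omega> > 0" "\<sigma> > 0" "\<omega> \<noteq> \<sigma>"
  shows "H_pairing_seq (wave c \<omega>) (wave d \<sigma>) t \<longlonglongrightarrow> 0"
proof -
  have "(\<lambda>n. H_pairing_seq (wave c \<omega>) (wave d \<sigma>) t n) \<longlonglongrightarrow>
    (Re (c * cnj d * cis ((\<omega> - \<sigma>) * t)) * 0 + Re (c * d * cis ((\<omega> + \<sigma>) * t)) * 0) / 2"
    unfolding H_pairing_seq_wave
    by (intro tendsto_intros kernel_offdiag_lim) (use assms in auto)
  then show ?thesis by simp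
qed

lemma half_sqrt_two_over_pi: "sqrt (2 / pi) / 2 = 1 / sqrt (2 * pi)"
  by (simp add: real_sqrt_mult real_sqrt_divide field_simps)

text \<open>The coefficient of the diagonal kernel loses its dependence on t because \<omega> -
  \<omega> = 0. The other kernel is off the diagonal, since \<omega> \<noteq> -\<omega>.\<close>

lemma pairing_diag:
  assumes "\<omega> > 0"
  shows "H_pairing_seq (wave c \<omega>) (wave d \<omega>) t \<longlonglongrightarrow> Re (c * cnj d) * (exp (\<omega>\<^sup>2) / sqrt (2 * pi))"
proof -
  have "(\<lambda>n. H_pairing_seq (wave c \<omega>) (wave d \<omega>) t n) \<longlonglongrightarrow>
    (Re (c * cnj d * cis ((\<omega> - \<omega>) * t)) * (sqrt (2 / pi) * exp (\<omega>\<^sup>2))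
      + Re (c * d * cis ((\<omega> + \<omega>) * t)) * 0) / 2"
    unfolding H_pairing_seq_wave
    by (intro tendsto_intros kernel_offdiag_lim kernel_diag_lim) (use assms in auto)
  moreover have "Re (c * cnj d) * (sqrt (2 / pi) * exp (\<omega>\<^sup>2)) / 2
      = Re (c * cnj d) * (exp (\<omega>\<^sup>2) * (sqrt (2 / pi) / 2))" by simp
  ultimately show ?thesis unfolding half_sqrt_two_over_pi by simp
qed

lemma nu_eq_pairing: "nu f n t = H_pairing_seq f f t n"
  by (simp add: nu_def H_pairing_seq_def power2_eq_square)

text \<open>In the formula for \<open>nu\<close>, t occurs only in the coefficient of the null
  sequence v, and that coefficient is bounded by the squared modulus of c. Convergence is therefore
  uniform on every set.\<close>

lemma wave_in_CH:
  assumes "\<omega> > 0"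
  shows "wave c \<omega> \<in> CH"
proof -
  define u v where "u = (\<lambda>n. hkernel n \<omega> \<omega> / sqrt (real (n + 1)))"
    and "v = (\<lambda>n. hkernel n \<omega> (- \<omega>) / sqrt (real (n + 1)))"
  obtain l where l: "u \<longlonglongrightarrow> l" unfolding u_def using kernel_diag_lim[of \<omega>] assms by auto
  have v: "v \<longlonglongrightarrow> 0" unfolding v_def using assms by (intro kernel_offdiag_lim) auto
  have "uniform_limit S (nu (wave c \<omega>)) (\<lambda>t. Re (c * cnj c) * l / 2) sequentially" for S
  proof (rule uniform_limitI)
    fix e :: real assume e: "e > 0"
    have "(\<lambda>n. (norm c)\<^sup>2 * \<bar>u n - l\<bar> + (norm c)\<^sup>2 * \<bar>v n\<bar>) \<longlonglongrightarrow> (norm c)\<^sup>2 * \<bar>l - l\<bar> + (norm c)\<^sup>2 * \<bar>0\<bar>"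
      by (intro tendsto_intros l v)
    then have "\<forall>\<^sub>F n in sequentially. (norm c)\<^sup>2 * \<bar>u n - l\<bar> + (norm c)\<^sup>2 * \<bar>v n\<bar> < e"
      using e by (intro order_tendstoD(2)[where y = 0]) simp_all
    then show "\<forall>\<^sub>F n in sequentially. \<forall>t\<in>S. dist (nu (wave c \<omega>) n t) (Re (c * cnj c) * l / 2) < e"
    proof eventually_elim
      case (elim n)
      show ?case
      proof
        fix t
        define a b where "a = Re (c * cnj c)" and "b = Re (c * c * cis ((\<omega> + \<omega>) * t))"
        have a: "\<bar>a\<bar> \<le> (norm c)\<^sup>2"
          unfolding a_def by (metis abs_Re_le_cmod complex_mod_cnj norm_mult power2_eq_square)
        have "\<bar>b\<bar> \<le> norm (c * c * cis ((\<omega> + \<omega>) * t))"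
          unfolding b_def by (rule abs_Re_le_cmod)
        then have b: "\<bar>b\<bar> \<le> (norm c)\<^sup>2"
          by (simp add: norm_mult power2_eq_square)
        have "nu (wave c \<omega>) n t - a * l / 2 = (a * (u n - l) + b * v n) / 2"
          unfolding nu_eq_pairing H_pairing_seq_wave u_def[symmetric] v_def[symmetric]
          by (simp add: a_def b_def u_def v_def algebra_simps add_divide_distrib diff_divide_distrib)
        then have "dist (nu (wave c \<omega>) n t) (a * l / 2) = \<bar>a * (u n - l) + b * v n\<bar> / 2"
          by (simp only: dist_real_def abs_divide abs_numeral)
        also have "\<dots> \<le> \<bar>a\<bar> * \<bar>u n - l\<bar> + \<bar>b\<bar> * \<bar>v n\<bar>"
          unfolding abs_mult[symmetric]
          by (rule order_trans[OF _ abs_triangle_ineq]) simp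
        also have "\<dots> \<le> (norm c)\<^sup>2 * \<bar>u n - l\<bar> + (norm c)\<^sup>2 * \<bar>v n\<bar>"
          by (intro add_mono mult_right_mono a b) auto
        finally show "dist (nu (wave c \<omega>) n t) (Re (c * cnj c) * l / 2) < e"
          using elim by (simp add: a_def)
      qed
    qed
  qed
  then show ?thesis
    unfolding CH_def uniformly_convergent_on_def using wave_entire by blast
qed

section \<open>Independence of the representatives\<close>

text \<open>The k-th derivative is the real part of the k-th complex derivative of the entire
  extension, restricted to the real line. This makes \<open>deriv\<close> additive on
  \<open>CH\<close>, as \<open>cderiv_diff\<close> requires.\<close>

lemma CH_higher_deriv_differentiable:
  assumes "f \<in> CH"
  shows "(deriv ^^ k) f field_differentiable (at t)"
proof -
  have real_part: "((\<lambda>t. Re (G (of_real t))) has_field_derivative Re (deriv G (of_real t))) (at t)"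
    if "G holomorphic_on UNIV" for G and t :: real
  proof -
    have "(G has_field_derivative deriv G (of_real t)) (at (of_real t))"
      using that by (intro holomorphic_derivI) auto
    then have "((\<lambda>t. G (of_real t)) has_vector_derivative deriv G (of_real t)) (at t)"
      by (rule has_vector_derivative_real_field)
    then have "((\<lambda>t. Re (G (of_real t))) has_vector_derivative Re (deriv G (of_real t))) (at t)"
      by (rule bounded_linear.has_vector_derivative[OF bounded_linear_Re])
    then show ?thesis by (simp add: has_real_derivative_iff_has_vector_derivative)
  qed
  have "\<exists>G. G holomorphic_on UNIV \<and> (deriv ^^ k) f = (\<lambda>t. Re (G (of_real t)))" for k
  proof (induction k)
    case 0
    from assms obtain F where "F holomorphic_on UNIV" "\<forall>t. F (of_real t) = complex_of_real (f t)"
      unfolding CH_def by blast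
    then show ?case by (intro exI[of _ F]) (simp add: fun_eq_iff)
  next
    case (Suc k)
    then obtain G where G: "G holomorphic_on UNIV" "(deriv ^^ k) f = (\<lambda>t. Re (G (of_real t)))"
      by blast
    have "(deriv ^^ Suc k) f = (\<lambda>t. Re (deriv G (of_real t)))"
      using real_part[OF G(1)] by (simp add: G(2) fun_eq_iff DERIV_imp_deriv)
    moreover have "deriv G holomorphic_on UNIV"
      using G(1) by (intro holomorphic_deriv) auto
    ultimately show ?case by blast
  qed
  then obtain G where "G holomorphic_on UNIV" "(deriv ^^ k) f = (\<lambda>t. Re (G (of_real t)))" by blast
  then show ?thesis using real_part unfolding field_differentiable_def by metis
qed

lemma cderiv_diff:
  assumes "f \<in> CH" "g \<in> CH"
  shows "cderiv n (\<lambda>s. f s - g s) t = cderiv n f t - cderiv n g t"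
proof -
  have "(deriv ^^ k) (\<lambda>s. f s - g s) = (\<lambda>s. (deriv ^^ k) f s - (deriv ^^ k) g s)" for k
  proof (induction k)
    case (Suc k)
    then show ?case
      using assms by (simp only: funpow.simps o_apply) (simp add: CH_higher_deriv_differentiable)
  qed simp
  then have "cderiv_complex n (\<lambda>s. f s - g s) t = cderiv_complex n f t - cderiv_complex n g t"
    unfolding cderiv_complex_def by (simp add: algebra_simps sum_subtractf)
  then show ?thesis by (simp add: cderiv_def)
qed

lemma pairing_cauchy_schwarz: "\<bar>H_pairing_seq f g t n\<bar> \<le> sqrt (nu f n t) * sqrt (nu g n t)"
proof -
  define s where "s = 1 / sqrt (real (n + 1))"
  have s: "s \<ge> 0" by (simp add: s_def)
  have "\<bar>\<Sum>k=0..n. cderiv k f t * cderiv k g t\<bar>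
      \<le> sqrt (\<Sum>k=0..n. (cderiv k f t)\<^sup>2) * sqrt (\<Sum>k=0..n. (cderiv k g t)\<^sup>2)"
    using sum_abs[of "\<lambda>k. cderiv k f t * cderiv k g t" "{0..n}"]
      L2_set_mult_ineq[of "\<lambda>k. cderiv k f t" "\<lambda>k. cderiv k g t" "{0..n}"]
    unfolding L2_set_def abs_mult by linarith
  then have "s * \<bar>\<Sum>k=0..n. cderiv k f t * cderiv k g t\<bar>
      \<le> s * (sqrt (\<Sum>k=0..n. (cderiv k f t)\<^sup>2) * sqrt (\<Sum>k=0..n. (cderiv k g t)\<^sup>2))"
    using s by (rule mult_left_mono)
  also have "\<dots> = sqrt (nu f n t) * sqrt (nu g n t)"
  proof -
    have "sqrt s * sqrt s = s" using s by simp
    then show ?thesis unfolding nu_def s_def[symmetric] real_sqrt_mult by (simp add: mult_ac)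
  qed
  finally show ?thesis unfolding H_pairing_seq_def s_def[symmetric] using s by (simp add: abs_mult)
qed

lemma nu_convergent:
  assumes "f \<in> CH"
  shows "\<exists>l. (\<lambda>n. nu f n t) \<longlonglongrightarrow> l"
proof -
  have "uniformly_convergent_on {t..t} (nu f)" using assms unfolding CH_def by blast
  then obtain l where "uniform_limit {t..t} (nu f) l sequentially"
    unfolding uniformly_convergent_on_def by blast
  then have "(\<lambda>n. nu f n t) \<longlonglongrightarrow> l t" by (rule tendsto_uniform_limitI) simp
  then show ?thesis by blast
qed

text \<open>Cauchy-Schwarz: \<open>nu f\<close> tends to 0 while \<open>nu g\<close> converges
  because g lies in \<open>CH\<close>.\<close>

lemma pairing_null:
  assumes "(\<lambda>n. nu f n t) \<longlonglongrightarrow> 0" "g \<in> CH"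
  shows "H_pairing_seq f g t \<longlonglongrightarrow> 0"
proof -
  obtain l where l: "(\<lambda>n. nu g n t) \<longlonglongrightarrow> l" using nu_convergent[OF assms(2)] by blast
  show ?thesis
  proof (rule Lim_null_comparison)
    show "\<forall>\<^sub>F n in sequentially. norm (H_pairing_seq f g t n) \<le> sqrt (nu f n t) * sqrt (nu g n t)"
      using pairing_cauchy_schwarz by simp
    have "(\<lambda>n. sqrt (nu f n t) * sqrt (nu g n t)) \<longlonglongrightarrow> sqrt 0 * sqrt l"
      by (intro tendsto_intros assms l)
    then show "(\<lambda>n. sqrt (nu f n t) * sqrt (nu g n t)) \<longlonglongrightarrow> 0" by simp
  qed
qed

lemma pairing_commute: "H_pairing_seq f g = H_pairing_seq g f"
  by (simp add: fun_eq_iff H_pairing_seq_def mult.commute)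

lemma pairing_diff_left:
  assumes "f \<in> CH" "f' \<in> CH"
  shows "H_pairing_seq (\<lambda>s. f s - f' s) g t n = H_pairing_seq f g t n - H_pairing_seq f' g t n"
  using assms unfolding H_pairing_seq_def
  by (simp add: cderiv_diff left_diff_distrib sum_subtractf diff_divide_distrib)

lemma pairing_replace_left:
  assumes "f' \<in> C2H_class f" "g \<in> CH" "H_pairing_seq f g t \<longlonglongrightarrow> c"
  shows "H_pairing_seq f' g t \<longlonglongrightarrow> c"
proof -
  from assms(1) have *: "f \<in> CH" "f' \<in> CH" "(\<lambda>n. nu (\<lambda>s. f s - f' s) n t) \<longlonglongrightarrow> 0"
    unfolding C2H_class_def null_rel_def by auto
  have "(\<lambda>n. H_pairing_seq f g t n - H_pairing_seq (\<lambda>s. f s - f' s) g t n) \<longlonglongrightarrow> c - 0"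
    by (intro tendsto_diff assms(3) pairing_null[OF *(3) assms(2)])
  then show ?thesis by (simp add: pairing_diff_left[OF *(1,2)])
qed

lemma C2H_class_refl:
  assumes "f \<in> CH"
  shows "f \<in> C2H_class f"
  using assms cderiv_diff[OF assms assms]
  by (simp add: C2H_class_def null_rel_def nu_def)

text \<open>Links the pointwise limits to the quotient: a limit known for one pair of
  representatives holds for all, so the definite description is determined.\<close>

lemma C2H_inner_eq:
  assumes "f \<in> CH" "g \<in> CH" "\<And>t. H_pairing_seq f g t \<longlonglongrightarrow> c"
  shows "C2H_inner (C2H_class f) (C2H_class g) = c"
  unfolding C2H_inner_def
proof (rule the_equality)
  show "\<forall>f'\<in>C2H_class f. \<forall>g'\<in>C2H_class g. \<forall>t. H_pairing_seq f' g' t \<longlonglongrightarrow> c"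
  proof (intro ballI allI)
    fix f' g' t assume f': "f' \<in> C2H_class f" and g': "g' \<in> C2H_class g"
    have "f' \<in> CH" using f' by (simp add: C2H_class_def null_rel_def)
    \<comment> \<open>\<open>pairing_replace_left\<close> acts on the first slot only; symmetry
      moves g there for the second replacement.\<close>
    moreover have "H_pairing_seq g f' t \<longlonglongrightarrow> c"
      using pairing_replace_left[OF f' assms(2,3)] by (simp add: pairing_commute)
    ultimately have "H_pairing_seq g' f' t \<longlonglongrightarrow> c" by (rule pairing_replace_left[OF g'])
    then show "H_pairing_seq f' g' t \<longlonglongrightarrow> c" by (simp add: pairing_commute)
  qed
next
  fix c' assume "\<forall>f'\<in>C2H_class f. \<forall>g'\<in>C2H_class g. \<forall>t. H_pairing_seq f' g' t \<longlonglongrightarrow> c'"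
  then have "H_pairing_seq f g 0 \<longlonglongrightarrow> c'" using assms C2H_class_refl by blast
  then show "c' = c" using assms(3) LIMSEQ_unique by blast
qed

section \<open>The sine and cosine family\<close>

lemma trig_familyE:
  assumes "f \<in> trig_family"
  obtains c \<omega> where "f = wave c \<omega>" "c \<in> {1, - \<i>}" "\<omega> > 0"
  using assms unfolding trig_family_def by (auto simp: sin_fun_wave cos_fun_wave)

lemma sqrt_norm_value: "sqrt (exp (\<omega>\<^sup>2) / sqrt (2 * pi)) = exp (\<omega>\<^sup>2 / 2) / root 4 (2 * pi)"
proof -
  have "sqrt (sqrt x) = root 4 x" for x
    using real_root_mult_exp[of 2 2 x] by (simp add: sqrt_def)
  moreover have "sqrt (exp (\<omega>\<^sup>2)) = exp (\<omega>\<^sup>2 / 2)"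
    by (rule real_sqrt_unique) (simp_all flip: exp_double)
  ultimately show ?thesis by (simp add: real_sqrt_divide)
qed

theorem proposition7p6:
  shows "trig_family \<subseteq> CH \<and>
    (\<forall>f\<in>trig_family. \<forall>g\<in>trig_family. f \<noteq> g \<longrightarrow> (\<forall>t. H_pairing_seq f g t \<longlonglongrightarrow> 0)) \<and>
    (\<forall>\<omega>>0. \<forall>t. H_pairing_seq (sin_fun \<omega>) (sin_fun \<omega>) t \<longlonglongrightarrow> exp (\<omega>\<^sup>2) / sqrt (2 * pi)) \<and>
    (\<forall>\<omega>>0. \<forall>t. H_pairing_seq (cos_fun \<omega>) (cos_fun \<omega>) t \<longlonglongrightarrow> exp (\<omega>\<^sup>2) / sqrt (2 * pi)) \<and>
    C2H_class ` trig_family \<subseteq> C2H \<and>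
    (\<forall>f\<in>trig_family. \<forall>g\<in>trig_family. f \<noteq> g \<longrightarrow> C2H_inner (C2H_class f) (C2H_class g) = 0) \<and>
    (\<forall>\<omega>>0. C2H_norm (C2H_class (sin_fun \<omega>)) = exp (\<omega>\<^sup>2 / 2) / root 4 (2 * pi)) \<and>
    (\<forall>\<omega>>0. C2H_norm (C2H_class (cos_fun \<omega>)) = exp (\<omega>\<^sup>2 / 2) / root 4 (2 * pi))"
proof -
  have CH: "f \<in> CH" if "f \<in> trig_family" for f
    using that wave_in_CH by (auto elim!: trig_familyE)
  have orth: "H_pairing_seq f g t \<longlonglongrightarrow> 0"
    if f: "f \<in> trig_family" and g: "g \<in> trig_family" and ne: "f \<noteq> g" for f g t
  proof -
    obtain c \<omega> where f: "f = wave c \<omega>" "c \<in> {1, - \<i>}" "\<omega> > 0" using f by (rule trig_familyE)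
    obtain d \<sigma> where g: "g = wave d \<sigma>" "d \<in> {1, - \<i>}" "\<sigma> > 0" using g by (rule trig_familyE)
    show ?thesis
    proof (cases "\<omega> = \<sigma>")
      case False
      then show ?thesis unfolding f(1) g(1) using f(3) g(3) by (intro pairing_offdiag)
    next
      case True
      \<comment> \<open>With equal frequencies one function is the sine and the other the cosine, so
        \<open>c * cnj d\<close> is \<i> or -\<i>.\<close>
      then have "c \<noteq> d" using ne f(1) g(1) by auto
      then have "Re (c * cnj d) = 0" using f(2) g(2) by auto
      then show ?thesis using pairing_diag[OF f(3), of c d t] f(1) g(1) True by simp
    qed
  qed
  have diag: "H_pairing_seq (wave c \<omega>) (wave c \<omega>) t \<longlonglongrightarrow> exp (\<omega>\<^sup>2) / sqrt (2 * pi)"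
    if "c \<in> {1, - \<i>}" "\<omega> > 0" for c \<omega> t
    using pairing_diag[OF that(2), of c c t] that(1) by auto
  have norm: "C2H_norm (C2H_class (wave c \<omega>)) = exp (\<omega>\<^sup>2 / 2) / root 4 (2 * pi)"
    if "c \<in> {1, - \<i>}" "\<omega> > 0" for c \<omega>
    unfolding C2H_norm_def
    by (subst C2H_inner_eq[OF wave_in_CH wave_in_CH diag]) (use that sqrt_norm_value in auto)
  show ?thesis
  proof (intro conjI ballI allI impI subsetI)
    show "X \<in> C2H" if "X \<in> C2H_class ` trig_family" for X
      using that CH unfolding C2H_def C2H_class_def by (auto intro: quotientI)
  qed (use CH orth diag norm in \<open>auto simp: sin_fun_wave cos_fun_wave intro!: C2H_inner_eq\<close>)
qed

end
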